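(* Let $M_1=(E,\mathcal{I}_1)$ be a laminar matroid such that $E\in\mathcal{I}_1^2$, and let $M_2=(E,\mathcal{I}_2)$ be a matroid on the same ground set $E$ such that no element of $E$ is $3$-spanned in $M_2$. Then there exists a partition $\{X_1,X_2\}$ of $E$ such that $X_1,X_2\in\mathcal{I}_1\cap\mathcal{I}_2$.
   Context: $E$ is a finite set; a matroid $(E,\mathcal{I})$ is given by its family $\mathcal{I}\subseteq 2^E$ of independent sets. A partition of $E$ is a family of pairwise disjoint subsets of $E$ with union $E$; empty members are allowed. For a matroid $(E,\mathcal{I})$ and a positive integer $k$, $\mathcal{I}^k$ is the family of all $X\subseteq E$ that can be partitioned into $k$ sets in $\mathcal{I}$. Laminar matroid: a family $\mathcal{A}\subseteq 2^E$ is laminar if for all $A_1,A_2\in\mathcal{A}$ we have $A_1\subseteq A_2$, $A_2\subseteq A_1$, or $A_1\cap A_2=\emptyset$. Given a laminar family $\mathcal{A}$ and $q:\mathcal{A}\to\mathbf{Z}_{\geq 0}$, the pair $(E,\mathcal{I})$ with $\mathcal{I}=\{X\subseteq E\mid |X\cap A|\le q(A)\ \text{for all } A\in\mathcal{A}\}$ is a matroid; a matroid arising in this way is called laminar. Spanning: in a matroid with rank function $r$, a set $X\subseteq E$ spans $e\in E$ if $r(X\cup\{e\})=r(X)$. For a positive integer $m$, an element $e$ is $m$-spanned if there exist $m$ pairwise disjoint subsets $S_1,\dots,S_m$ of $E$ each spanning $e$ (the trivial spanning set $\{e\}$ may be one of them; the $S_i$ form an indexed family, so empty sets are allowed and may be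 repeated, which matters only when $e$ is a loop). *)

theory Defs
  imports Main "HOL-Library.Disjoint_Sets"
begin

locale matroid =
  fixes E :: "'a set" and \<I> :: "'a set set"
  assumes finite_ground: "finite E"
    and indep_subset_ground: "X \<in> \<I> \<Longrightarrow> X \<subseteq> E"
    and empty_indep: "{} \<in> \<I>"
    and indep_mono: "X \<in> \<I> \<Longrightarrow> Y \<subseteq> X \<Longrightarrow> Y \<in> \<I>"
    and augmentation:
      "X \<in> \<I> \<Longrightarrow> Y \<in> \<I> \<Longrightarrow> card X < card Y \<Longrightarrow> \<exists>e \<in> Y - X. insert e X \<in> \<I>"

definition mrank :: "'a set set \<Rightarrow> 'a set \<Rightarrow> nat" where
  "mrank \<I> X = Max (card ` {Y \<in> \<I>. Y \<subseteq> X})"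

definition spans :: "'a set set \<Rightarrow> 'a set \<Rightarrow> 'a \<Rightarrow> bool" where
  "spans \<I> S e \<longleftrightarrow> mrank \<I> (S \<union> {e}) = mrank \<I> S"

text \<open>
  The families below are indexed by \<open>{..<k}\<close> rather than being sets of sets, so that
  empty members are allowed and may be repeated.
\<close>

definition m_spanned :: "'a set \<Rightarrow> 'a set set \<Rightarrow> nat \<Rightarrow> 'a \<Rightarrow> bool" where
  "m_spanned E \<I> m e \<longleftrightarrow>
     (\<exists>S :: nat \<Rightarrow> 'a set. disjoint_family_on S {..<m} \<and>
        (\<forall>i<m. S i \<subseteq> E \<and> spans \<I> (S i) e))"

definition k_fold_indep :: "'a set \<Rightarrow> 'a set set \<Rightarrow> nat \<Rightarrow> 'a set set" where
  "k_fold_indep E \<I> k =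
     {X. X \<subseteq> E \<and> (\<exists>P :: nat \<Rightarrow> 'a set. disjoint_family_on P {..<k} \<and>
        (\<Union>i<k. P i) = X \<and> (\<forall>i<k. P i \<in> \<I>))}"

definition laminar :: "'a set set \<Rightarrow> bool" where
  "laminar \<A> \<longleftrightarrow> (\<forall>A\<in>\<A>. \<forall>B\<in>\<A>. A \<subseteq> B \<or> B \<subseteq> A \<or> A \<inter> B = {})"

definition laminar_matroid :: "'a set \<Rightarrow> 'a set set \<Rightarrow> bool" where
  "laminar_matroid E \<I> \<longleftrightarrow> matroid E \<I> \<and>
     (\<exists>\<A> (q :: 'a set \<Rightarrow> nat). \<A> \<subseteq> Pow E \<and> laminar \<A> \<and>
        \<I> = {X. X \<subseteq> E \<and> (\<forall>A\<in>\<A>. card (X \<inter> A) \<le> q A)})"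

end

theory Submission
  imports Defs
begin

text \<open>
  The laminar matroid enters only through a pairing of the ground set. Since \<open>E\<close> is a union
  of two independent sets, every member \<open>A\<close> of the laminar family has at most \<open>2 * q A\<close> elements,
  so a set is independent in the first matroid as soon as it contains at most half of each
  \<open>A\<close>, rounded up. Pairing up elements inside the smallest members first
  (\<open>laminar_pairing\<close>) gives disjoint two-element sets, missing at most one element of \<open>E\<close>, such that
  every set containing exactly one element of each pair has this property. It remains to split
  the pairs so that both halves are independent in the second matroid.

  That no element is 3-spanned there is used as an inequality for the rank function \<open>r\<close>,
  \<open>r A + r B \<ge> r (A - B) + r (B - A) + |A \<inter> B|\<close> (\<open>cross_inequality\<close>): bases chosen greedily in \<open>A\<close>
  and then in the rest of \<open>B\<close> have to exhaust \<open>A \<inter> B\<close>, because an element left over would be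
  spanned by both of them and by itself. In polyhedral terms this says that the sets \<open>X\<close> with \<open>X\<close>
  and \<open>E - X\<close> independent are the integer points of a generalized polymatroid. The case \<open>A = B\<close>
  puts the vector with all entries \<open>1/2\<close> into it, and that vector also gives weight \<open>1\<close> to each
  pair; integrality of the intersection then yields a suitable set.

  Instead of appealing to integrality, the pairs are split one at a time, as in the proof of Rado's
  theorem. If \<open>X\<close> and \<open>Y\<close> are the parts built so far, the invariant is that
  \<open>r (X \<union> \<Union>Q) \<ge> |X| + |Q|\<close> for each set \<open>Q\<close> of pairs not yet split, and likewise for \<open>Y\<close>.
  If neither way of splitting the next pair preserved the invariant, two violating sets would
  contradict submodularity when they concern the same part, and the cross inequality
  when they concern different parts.
\<close>

section \<open>Rank in a matroid\<close>

context matroid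
begin

lemma finite_indep: "Y \<in> \<I> \<Longrightarrow> finite Y"
  using finite_ground indep_subset_ground finite_subset by blast

lemma finite_indep_sets: "finite {Y \<in> \<I>. Y \<subseteq> X}"
proof (rule finite_subset)
  show "{Y \<in> \<I>. Y \<subseteq> X} \<subseteq> Pow E" using indep_subset_ground by blast
  show "finite (Pow E)" using finite_ground by simp
qed

lemma card_le_mrank: "Y \<in> \<I> \<Longrightarrow> Y \<subseteq> X \<Longrightarrow> card Y \<le> mrank \<I> X"
  unfolding mrank_def by (rule Max_ge) (use finite_indep_sets in auto)

lemma mrank_attained: "\<exists>B\<in>\<I>. B \<subseteq> X \<and> card B = mrank \<I> X"
proof -
  have "mrank \<I> X \<in> card ` {Y \<in> \<I>. Y \<subseteq> X}"
    unfolding mrank_def by (rule Max_in) (use finite_indep_sets empty_indep in auto)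
  then show ?thesis by auto
qed

lemma extend_to_basis:
  assumes "Z \<in> \<I>" "Z \<subseteq> X"
  obtains B where "B \<in> \<I>" "Z \<subseteq> B" "B \<subseteq> X" "card B = mrank \<I> X"
proof -
  have "\<exists>B\<in>\<I>. Z \<subseteq> B \<and> B \<subseteq> X \<and> card B = mrank \<I> X"
    using assms
  proof (induction "mrank \<I> X - card Z" arbitrary: Z)
    case 0
    then have "card Z = mrank \<I> X" using card_le_mrank[of Z X] by simp
    then show ?case using 0 by blast
  next
    case (Suc n)
    obtain B where B: "B \<in> \<I>" "B \<subseteq> X" "card B = mrank \<I> X" using mrank_attained by blast
    with Suc.hyps(2) have "card Z < card B" by simp
    then obtain e where e: "e \<in> B - Z" "insert e Z \<in> \<I>"
      using augmentation Suc.prems(1) B(1) by blast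
    have "card (insert e Z) = Suc (card Z)"
      using e(1) finite_indep[OF Suc.prems(1)] by simp
    then have "n = mrank \<I> X - card (insert e Z)" using Suc.hyps(2) by simp
    then show ?case using Suc.hyps(1)[of "insert e Z"] e B(2) Suc.prems by auto
  qed
  then show ?thesis using that by blast
qed

lemma basis_exists:
  obtains B where "B \<in> \<I>" "B \<subseteq> X" "card B = mrank \<I> X"
  using mrank_attained by blast

lemma mrank_mono:
  assumes "A \<subseteq> B"
  shows "mrank \<I> A \<le> mrank \<I> B"
  by (metis assms card_le_mrank mrank_attained order_trans)

lemma mrank_submodular: "mrank \<I> (A \<union> B) + mrank \<I> (A \<inter> B) \<le> mrank \<I> A + mrank \<I> B"
proof -
  obtain K where K: "K \<in> \<I>" "K \<subseteq> A \<inter> B" "card K = mrank \<I> (A \<inter> B)"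
    by (rule basis_exists)
  moreover have "K \<subseteq> A \<union> B" using K(2) by blast
  ultimately obtain C where C: "C \<in> \<I>" "K \<subseteq> C" "C \<subseteq> A \<union> B" "card C = mrank \<I> (A \<union> B)"
    using extend_to_basis by metis
  have fin: "finite C" using C(1) finite_indep by blast
  have "C = (C \<inter> A) \<union> (C \<inter> B)" using C(3) by blast
  then have "card (C \<inter> A) + card (C \<inter> B) = card C + card ((C \<inter> A) \<inter> (C \<inter> B))"
    using card_Un_Int[of "C \<inter> A" "C \<inter> B"] fin by simp
  moreover have "card K \<le> card ((C \<inter> A) \<inter> (C \<inter> B))"
    by (rule card_mono) (use K(2) C(2) fin in auto)
  moreover have "card (C \<inter> A) \<le> mrank \<I> A" "card (C \<inter> B) \<le> mrank \<I> B"
    by (rule card_le_mrank; use C(1) indep_mono in blast)+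
  ultimately show ?thesis using K(3) C(4) by linarith
qed

lemma indep_if_card_le_mrank:
  assumes "finite X" "card X \<le> mrank \<I> X"
  shows "X \<in> \<I>"
proof -
  obtain B where "B \<in> \<I>" "B \<subseteq> X" "card B = mrank \<I> X" by (rule basis_exists)
  moreover have "B = X" using calculation assms card_seteq by metis
  ultimately show ?thesis by simp
qed

lemma basis_spans:
  assumes B: "B \<in> \<I>" "B \<subseteq> X" "card B = mrank \<I> X" and "e \<in> X"
  shows "spans \<I> B e"
proof -
  have "mrank \<I> (B \<union> {e}) \<le> mrank \<I> X" by (rule mrank_mono) (use assms in auto)
  moreover have "card B \<le> mrank \<I> B" using card_le_mrank B(1) by blast
  moreover have "mrank \<I> B \<le> mrank \<I> (B \<union> {e})" by (rule mrank_mono) auto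
  ultimately show ?thesis unfolding spans_def using B(3) by linarith
qed

end

section \<open>Matroids without 3-spanned elements\<close>

locale matroid_without_3_spanned = matroid +
  assumes no_3_spanned: "e \<in> E \<Longrightarrow> \<not> m_spanned E \<I> 3 e"
begin

lemma no_two_disjoint_spanning_sets:
  assumes "e \<in> E" "S \<subseteq> E" "T \<subseteq> E" "S \<inter> T = {}" "e \<notin> S" "e \<notin> T"
    "spans \<I> S e" "spans \<I> T e"
  shows False
proof -
  define F :: "nat \<Rightarrow> 'a set" where "F = (\<lambda>i. if i = 0 then S else if i = 1 then T else {e})"
  have "disjoint_family_on F {..<3}"
    using assms unfolding disjoint_family_on_def F_def by auto
  moreover have "\<forall>i<3. F i \<subseteq> E \<and> spans \<I> (F i) e"
    using assms unfolding F_def spans_def by auto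
  ultimately have "m_spanned E \<I> 3 e" unfolding m_spanned_def by blast
  then show False using no_3_spanned assms(1) by blast
qed

text \<open>
  A basis \<open>C\<close> of \<open>A\<close> and a basis \<open>D\<close> of \<open>B - C\<close> together cover \<open>A \<inter> B\<close>, as any element left over
  would be spanned by \<open>C\<close>, by \<open>D\<close> and by itself. Letting them extend bases of \<open>A - B\<close> and
  \<open>B - A\<close> bounds the number of their elements in \<open>A \<inter> B\<close> by the rank differences.
\<close>

lemma cross_inequality:
  assumes "A \<subseteq> E" "B \<subseteq> E"
  shows "mrank \<I> (A - B) + mrank \<I> (B - A) + card (A \<inter> B) \<le> mrank \<I> A + mrank \<I> B"
proof -
  obtain K where K: "K \<in> \<I>" "K \<subseteq> A - B" "card K = mrank \<I> (A - B)"
    by (rule basis_exists)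
  moreover have "K \<subseteq> A" using K(2) by blast
  ultimately obtain C where C: "C \<in> \<I>" "K \<subseteq> C" "C \<subseteq> A" "card C = mrank \<I> A"
    using extend_to_basis by metis
  obtain L where L: "L \<in> \<I>" "L \<subseteq> B - A" "card L = mrank \<I> (B - A)"
    by (rule basis_exists)
  moreover have "L \<subseteq> B - C" using L(2) C(3) by blast
  ultimately obtain D where D: "D \<in> \<I>" "L \<subseteq> D" "D \<subseteq> B - C" "card D = mrank \<I> (B - C)"
    using extend_to_basis by metis
  have fin: "finite C" "finite D" using C(1) D(1) finite_indep by blast+
  have cover: "A \<inter> B \<subseteq> C \<union> D"
  proof
    fix e assume e: "e \<in> A \<inter> B"
    show "e \<in> C \<union> D"
    proof (rule ccontr)
      assume out: "e \<notin> C \<union> D"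
      have "spans \<I> C e" using basis_spans[OF C(1,3,4)] e by blast
      moreover have "spans \<I> D e" using basis_spans[OF D(1,3,4)] e out by blast
      moreover have "C \<inter> D = {}" using D(3) by blast
      ultimately show False
        using no_two_disjoint_spanning_sets[of e C D] e out assms
          indep_subset_ground[OF C(1)] indep_subset_ground[OF D(1)] by blast
    qed
  qed
  have "card (A \<inter> B) \<le> card ((C - K) \<union> (D - L))"
    by (rule card_mono) (use cover fin K(2) L(2) in auto)
  also have "\<dots> \<le> card (C - K) + card (D - L)" by (rule card_Un_le)
  also have "card (C - K) = card C - card K"
    using card_Diff_subset finite_indep[OF K(1)] C(2) by blast
  also have "card (D - L) = card D - card L"
    using card_Diff_subset finite_indep[OF L(1)] D(2) by blast
  finally have "card (A \<inter> B) \<le> (card C - card K) + (card D - card L)" .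
  moreover have "card K \<le> card C" "card L \<le> card D"
    using card_mono fin C(2) D(2) by blast+
  moreover have "card D \<le> mrank \<I> B" using D card_le_mrank by blast
  ultimately show ?thesis using K(3) C(4) L(3) by linarith
qed

lemma card_le_twice_mrank:
  assumes "A \<subseteq> E"
  shows "card A \<le> 2 * mrank \<I> A"
  using cross_inequality[OF assms assms] by simp

end

section \<open>Splitting pairs into two independent sets\<close>

lemma Union_Int_of_disjoint:
  assumes "disjoint P" "Q \<subseteq> P" "R \<subseteq> P"
  shows "\<Union>Q \<inter> \<Union>R = \<Union>(Q \<inter> R)"
proof
  show "\<Union>Q \<inter> \<Union>R \<subseteq> \<Union>(Q \<inter> R)"
  proof
    fix x assume "x \<in> \<Union>Q \<inter> \<Union>R"
    then obtain q r where "q \<in> Q" "r \<in> R" "x \<in> q" "x \<in> r" by blast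
    moreover have "q = r" using calculation assms unfolding disjoint_def by blast
    ultimately show "x \<in> \<Union>(Q \<inter> R)" by blast
  qed
qed blast

lemma card_Union_pairs:
  assumes "disjoint Q" "\<forall>p\<in>Q. card p = 2"
  shows "card (\<Union>Q) = 2 * card Q"
proof -
  have "finite p" if "p \<in> Q" for p
    using assms(2) that by (metis card.infinite zero_neq_numeral)
  then have "card (\<Union>Q) = sum card Q"
    using assms(1) by (intro card_Union_disjoint)
  also have "\<dots> = (\<Sum>p\<in>Q. 2)" by (rule sum.cong) (use assms(2) in auto)
  finally show ?thesis by simp
qed

context matroid_without_3_spanned
begin

text \<open>
  This is Rado's condition for choosing one element from each pair in \<open>P\<close> so that the chosen
  elements together with \<open>X\<close> form an independent set.
\<close>

definition extendable :: "'a set \<Rightarrow> 'a set set \<Rightarrow> bool" where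
  "extendable X P \<longleftrightarrow> (\<forall>Q\<subseteq>P. card X + card Q \<le> mrank \<I> (X \<union> \<Union>Q))"

lemma extendableD: "extendable X P \<Longrightarrow> Q \<subseteq> P \<Longrightarrow> card X + card Q \<le> mrank \<I> (X \<union> \<Union>Q)"
  unfolding extendable_def by blast

lemma not_extendable_insert:
  assumes "\<not> extendable (insert c X) P" "finite X" "c \<notin> X"
  shows "\<exists>Q\<subseteq>P. mrank \<I> (insert c (X \<union> \<Union>Q)) \<le> card X + card Q"
proof -
  obtain Q where "Q \<subseteq> P" "\<not> card (insert c X) + card Q \<le> mrank \<I> (insert c X \<union> \<Union>Q)"
    using assms(1) unfolding extendable_def by blast
  with assms(2,3) show ?thesis by (intro exI[of _ Q]) simp
qed

text \<open>
  If the condition fails for both choices, with sets of pairs \<open>Q\<close> and \<open>R\<close>, then its instances for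
  \<open>Q \<inter> R\<close> and for \<open>Q \<union> R\<close> together with the new pair contradict submodularity, since the new pair
  counts once in the union while neither failing rank has room for its element.
\<close>

lemma extend_one_side:
  assumes ext: "extendable X (insert {a, b} P)"
    and P: "finite P" "disjoint P" "{a, b} \<notin> P" "a \<notin> \<Union>P" "b \<notin> \<Union>P"
    and X: "finite X" "a \<notin> X" "b \<notin> X" and "a \<noteq> b"
  shows "extendable (insert a X) P \<or> extendable (insert b X) P"
proof (rule ccontr)
  assume no: "\<not> ?thesis"
  then obtain Q where Q: "Q \<subseteq> P" "mrank \<I> (insert a (X \<union> \<Union>Q)) \<le> card X + card Q"
    using not_extendable_insert[of a X P] X by blast
  from no obtain R where R: "R \<subseteq> P" "mrank \<I> (insert b (X \<union> \<Union>R)) \<le> card X + card R"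
    using not_extendable_insert[of b X P] X by blast
  have fin: "finite Q" "finite R"
    by (rule finite_subset[OF _ P(1)]; fact)+
  have un: "insert a (X \<union> \<Union>Q) \<union> insert b (X \<union> \<Union>R) = X \<union> \<Union>(insert {a, b} (Q \<union> R))"
    by auto
  have "a \<notin> \<Union>R" "b \<notin> \<Union>Q" using P(4,5) Q(1) R(1) by blast+
  moreover have "insert a (X \<union> V) \<inter> insert b (X \<union> W) = X \<union> (V \<inter> W)"
    if "a \<notin> W" "b \<notin> V" for V W
    using that X(2,3) \<open>a \<noteq> b\<close> by blast
  ultimately have int: "insert a (X \<union> \<Union>Q) \<inter> insert b (X \<union> \<Union>R) = X \<union> \<Union>(Q \<inter> R)"
    using Union_Int_of_disjoint[OF P(2) Q(1) R(1)] by metis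
  have "card X + card (insert {a, b} (Q \<union> R)) \<le> mrank \<I> (X \<union> \<Union>(insert {a, b} (Q \<union> R)))"
    by (rule extendableD[OF ext]) (use Q(1) R(1) in blast)
  moreover have "card X + card (Q \<inter> R) \<le> mrank \<I> (X \<union> \<Union>(Q \<inter> R))"
    by (rule extendableD[OF ext]) (use Q(1) in blast)
  moreover have "{a, b} \<notin> Q \<union> R" using P(3) Q(1) R(1) by blast
  then have "card (insert {a, b} (Q \<union> R)) = Suc (card (Q \<union> R))" using fin by simp
  moreover have "card Q + card R = card (Q \<union> R) + card (Q \<inter> R)"
    using card_Un_Int fin by blast
  ultimately show False
    using mrank_submodular[of "insert a (X \<union> \<Union>Q)" "insert b (X \<union> \<Union>R)"] Q(2) R(2)
    unfolding un int by linarith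
qed

text \<open>
  If the condition fails on both sides, with sets of pairs \<open>Q\<close> and \<open>R\<close>, the cross inequality is
  violated by \<open>A = X \<union> \<Union>Q\<close> and \<open>B = Y \<union> \<Union>R\<close>, both with the new element \<open>c\<close> added. A pair common
  to \<open>Q\<close> and \<open>R\<close> is lost in both differences, but its two elements lie in \<open>A \<inter> B\<close> and make up for
  that; the element \<open>c\<close> of \<open>A \<inter> B\<close> tips the balance.
\<close>

lemma extend_opposite_sides:
  assumes ext: "extendable X P" "extendable Y P"
    and P: "finite P" "disjoint P" "\<forall>p\<in>P. card p = 2" "\<Union>P \<subseteq> E"
    and XY: "X \<subseteq> E" "Y \<subseteq> E" "X \<inter> Y = {}" "X \<inter> \<Union>P = {}" "Y \<inter> \<Union>P = {}"
    and c: "c \<in> E" "c \<notin> X" "c \<notin> Y" "c \<notin> \<Union>P"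
  shows "extendable (insert c X) P \<or> extendable (insert c Y) P"
proof (rule ccontr)
  have finXY: "finite X" "finite Y"
    by (rule finite_subset[OF _ finite_ground]; fact)+
  assume no: "\<not> ?thesis"
  then obtain Q where Q: "Q \<subseteq> P" "mrank \<I> (insert c (X \<union> \<Union>Q)) \<le> card X + card Q"
    using not_extendable_insert[of c X P] c finXY by blast
  from no obtain R where R: "R \<subseteq> P" "mrank \<I> (insert c (Y \<union> \<Union>R)) \<le> card Y + card R"
    using not_extendable_insert[of c Y P] c finXY by blast
  let ?A = "insert c (X \<union> \<Union>Q)" and ?B = "insert c (Y \<union> \<Union>R)"
  have fin: "finite Q" "finite R"
    by (rule finite_subset[OF _ P(1)]; fact)+
  have QR: "\<Union>Q \<inter> \<Union>R = \<Union>(Q \<inter> R)" by (rule Union_Int_of_disjoint[OF P(2) Q(1) R(1)])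
  have Q_diff: "\<Union>(Q - R) \<inter> \<Union>R = {}"
    using Union_Int_of_disjoint[OF P(2), of "Q - R" R] Q(1) R(1) by auto
  have R_diff: "\<Union>(R - Q) \<inter> \<Union>Q = {}"
    using Union_Int_of_disjoint[OF P(2), of "R - Q" Q] Q(1) R(1) by auto
  have disj: "X \<inter> \<Union>R = {}" "Y \<inter> \<Union>Q = {}" "c \<notin> \<Union>Q" "c \<notin> \<Union>R"
    using XY(4,5) c(4) Q(1) R(1) by blast+
  have disj_diff: "Y \<inter> \<Union>(Q - R) = {}" "X \<inter> \<Union>(R - Q) = {}" "c \<notin> \<Union>(Q - R)" "c \<notin> \<Union>(R - Q)"
    using disj by blast+
  have diff: "S \<union> U \<subseteq> insert c (S \<union> V) - insert c (T \<union> W)"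
    if "S \<inter> T = {}" "S \<inter> W = {}" "U \<subseteq> V" "U \<inter> W = {}" "T \<inter> U = {}" "c \<notin> S" "c \<notin> U"
    for S T U V W :: "'a set"
    using that by blast
  have QRs: "\<Union>(Q - R) \<subseteq> \<Union>Q" "\<Union>(R - Q) \<subseteq> \<Union>R" by blast+
  have "Y \<inter> X = {}" using XY(3) by blast
  from mrank_mono[OF diff[OF this disj(2) QRs(2) R_diff disj_diff(2) c(3) disj_diff(4)]]
  have "mrank \<I> (Y \<union> \<Union>(R - Q)) \<le> mrank \<I> (?B - ?A)" .
  moreover from mrank_mono[OF diff[OF XY(3) disj(1) QRs(1) Q_diff disj_diff(1) c(2) disj_diff(3)]]
  have "mrank \<I> (X \<union> \<Union>(Q - R)) \<le> mrank \<I> (?A - ?B)" .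
  moreover have "card X + card (Q - R) \<le> mrank \<I> (X \<union> \<Union>(Q - R))"
    by (rule extendableD[OF ext(1)]) (use Q(1) in blast)
  moreover have "card Y + card (R - Q) \<le> mrank \<I> (Y \<union> \<Union>(R - Q))"
    by (rule extendableD[OF ext(2)]) (use R(1) in blast)
  moreover have "card (?A \<inter> ?B) = Suc (2 * card (Q \<inter> R))"
  proof -
    have "\<forall>p\<in>Q \<inter> R. card p = 2" "disjoint (Q \<inter> R)"
      using P(2,3) Q(1) unfolding disjoint_def by blast+
    then have two: "card (\<Union>(Q \<inter> R)) = 2 * card (Q \<inter> R)" by (rule card_Union_pairs[rotated])
    have "insert c (X \<union> V) \<inter> insert c (Y \<union> W) = insert c (V \<inter> W)"
      if "X \<inter> W = {}" "Y \<inter> V = {}" for V W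
      using that XY(3) by blast
    then have "?A \<inter> ?B = insert c (\<Union>(Q \<inter> R))" using QR disj(1,2) by metis
    moreover have "finite (\<Union>(Q \<inter> R))"
      using P(4) Q(1) finite_ground by (meson Int_lower1 Union_mono finite_subset order_trans)
    moreover have "c \<notin> \<Union>(Q \<inter> R)" using disj by blast
    ultimately show ?thesis using two by simp
  qed
  moreover have "card Q = card (Q - R) + card (Q \<inter> R)"
    using card_Diff_subset_Int[of Q R] card_mono[of Q "Q \<inter> R"] fin by simp
  moreover have "card R = card (R - Q) + card (Q \<inter> R)"
    using card_Diff_subset_Int[of R Q] card_mono[of R "R \<inter> Q"] fin by (simp add: Int_commute)
  moreover have "mrank \<I> (?A - ?B) + mrank \<I> (?B - ?A) + card (?A \<inter> ?B) \<le> mrank \<I> ?A + mrank \<I> ?B"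
    by (rule cross_inequality) (use XY c(1) P(4) Q(1) R(1) in blast)+
  ultimately show False using Q(2) R(2) by linarith
qed

lemma extendable_subset: "extendable X P \<Longrightarrow> Q \<subseteq> P \<Longrightarrow> extendable X Q"
  unfolding extendable_def by blast

lemma split_pairs:
  assumes "finite P" "disjoint P" "\<forall>p\<in>P. card p = 2" "\<Union>P \<subseteq> E"
    and "X \<subseteq> E" "Y \<subseteq> E" "X \<inter> Y = {}" "X \<inter> \<Union>P = {}" "Y \<inter> \<Union>P = {}"
    and "extendable X P" "extendable Y P"
  shows "\<exists>X' Y'. X' \<in> \<I> \<and> Y' \<in> \<I> \<and> X' \<inter> Y' = {} \<and> X' \<union> Y' = X \<union> Y \<union> \<Union>P \<and>
           X \<subseteq> X' \<and> Y \<subseteq> Y' \<and> (\<forall>p\<in>P. card (X' \<inter> p) = 1 \<and> card (Y' \<inter> p) = 1)"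
  using assms
proof (induction P arbitrary: X Y rule: finite_induct)
  case empty
  have "X \<in> \<I>" "Y \<in> \<I>"
    using empty.prems extendableD[of _ "{}" "{}"]
    by (auto intro!: indep_if_card_le_mrank intro: finite_subset[OF _ finite_ground])
  then show ?case using empty.prems by blast
next
  case (insert p P)
  obtain a b where p: "p = {a, b}" "a \<noteq> b"
    using insert.prems(2) card_2_iff by (metis insertI1)
  have P: "disjoint P" "\<forall>p\<in>P. card p = 2" "\<Union>P \<subseteq> E"
    using insert.prems(1-3) by (auto simp: disjoint_def)
  have "p \<inter> \<Union>P = {}"
    using insert.prems(1) insert.hyps(2) unfolding disjoint_def by auto
  then have ab: "a \<notin> \<Union>P" "b \<notin> \<Union>P" "a \<in> E" "b \<in> E" "a \<notin> X" "b \<notin> X" "a \<notin> Y" "b \<notin> Y"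
    using insert.prems p by auto
  have finXY: "finite X" "finite Y"
    by (rule finite_subset[OF _ finite_ground]; fact)+
  have ext: "extendable X P" "extendable Y P"
    using insert.prems(9,10) extendable_subset by blast+
  have XYP: "X \<inter> \<Union>P = {}" "Y \<inter> \<Union>P = {}" using insert.prems(7,8) by auto
  have "extendable (insert a X) P \<or> extendable (insert b X) P"
    using extend_one_side[of X a b P] insert.hyps insert.prems P p ab finXY by simp
  moreover have "extendable (insert a Y) P \<or> extendable (insert b Y) P"
    using extend_one_side[of Y a b P] insert.hyps insert.prems P p ab finXY by simp
  moreover have "extendable (insert c X) P \<or> extendable (insert c Y) P" if "c = a \<or> c = b" for c
    using that ab
    by (intro extend_opposite_sides[OF ext insert.hyps(1) P insert.prems(4-6) XYP]) auto
  \<comment> \<open>Each part can take \<open>a\<close> or \<open>b\<close>, and each of \<open>a\<close>, \<open>b\<close> fits into some part;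
    so the two elements can go to different parts.\<close>
  ultimately have "\<exists>c d. p = {c, d} \<and> c \<noteq> d \<and>
      extendable (insert c X) P \<and> extendable (insert d Y) P"
    using p by (metis doubleton_eq_iff)
  then obtain c d where cd: "p = {c, d}" "c \<noteq> d"
    "extendable (insert c X) P" "extendable (insert d Y) P" by blast
  then have cd': "c \<notin> \<Union>P" "d \<notin> \<Union>P" "c \<in> E" "d \<in> E" "c \<notin> X" "d \<notin> X" "c \<notin> Y" "d \<notin> Y"
    using ab p by (auto simp: doubleton_eq_iff)
  have "\<exists>X' Y'. X' \<in> \<I> \<and> Y' \<in> \<I> \<and> X' \<inter> Y' = {} \<and>
      X' \<union> Y' = insert c X \<union> insert d Y \<union> \<Union>P \<and> insert c X \<subseteq> X' \<and> insert d Y \<subseteq> Y' \<and>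
      (\<forall>p\<in>P. card (X' \<inter> p) = 1 \<and> card (Y' \<inter> p) = 1)"
  proof (rule insert.IH[OF P _ _ _ _ _ cd(3,4)])
    show "insert c X \<subseteq> E" "insert d Y \<subseteq> E" using cd'(3,4) insert.prems(4,5) by blast+
    show "insert c X \<inter> insert d Y = {}" using cd(2) cd'(6,7) insert.prems(6) by blast
    show "insert c X \<inter> \<Union>P = {}" "insert d Y \<inter> \<Union>P = {}" using cd'(1,2) XYP by blast+
  qed
  then obtain X' Y' where XY': "X' \<in> \<I>" "Y' \<in> \<I>" "X' \<inter> Y' = {}"
    "X' \<union> Y' = insert c X \<union> insert d Y \<union> \<Union>P" "insert c X \<subseteq> X'" "insert d Y \<subseteq> Y'"
    "\<forall>p\<in>P. card (X' \<inter> p) = 1 \<and> card (Y' \<inter> p) = 1" by (elim exE conjE)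
  have "X' \<inter> p = {c}" "Y' \<inter> p = {d}" using cd(1) XY'(3,5,6) by auto
  then have "\<forall>p\<in>insert p P. card (X' \<inter> p) = 1 \<and> card (Y' \<inter> p) = 1" using XY'(7) by simp
  moreover have "X' \<union> Y' = X \<union> Y \<union> \<Union>(insert p P)" using XY'(4) cd(1) by auto
  ultimately show ?case using XY'(1-3,5,6) by blast
qed

text \<open>
  The invariant holds at the start because \<open>r A \<ge> |A| / 2\<close>. An unpaired element can be put into
  either part beforehand: together with any pairs it forms a set of odd size, for which the bound
  rounds up.
\<close>

lemma split_pairing:
  assumes P: "finite P" "disjoint P" "\<forall>p\<in>P. card p = 2" "\<Union>P \<subseteq> E"
    and rest: "card (E - \<Union>P) \<le> 1"
  shows "\<exists>X Y. X \<in> \<I> \<and> Y \<in> \<I> \<and> X \<inter> Y = {} \<and> X \<union> Y = E \<and>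
           (\<forall>p\<in>P. card (X \<inter> p) = 1 \<and> card (Y \<inter> p) = 1)"
proof -
  have ext: "extendable Z P" if Z: "Z \<subseteq> E - \<Union>P" for Z
    unfolding extendable_def
  proof (intro allI impI)
    fix Q assume Q: "Q \<subseteq> P"
    have QE: "\<Union>Q \<subseteq> E" using Q P(4) by blast
    have finZ: "finite Z" using Z finite_ground by (meson Diff_subset finite_subset)
    have "card Z \<le> card (E - \<Union>P)" by (rule card_mono) (use Z finite_ground in auto)
    moreover have "card (Z \<union> \<Union>Q) = card Z + card (\<Union>Q)"
      by (rule card_Un_disjoint) (use Z Q QE finZ finite_ground finite_subset in blast)+
    moreover have "card (\<Union>Q) = 2 * card Q"
      by (rule card_Union_pairs) (use P(2,3) Q in \<open>auto simp: disjoint_def\<close>)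
    moreover have "card (Z \<union> \<Union>Q) \<le> 2 * mrank \<I> (Z \<union> \<Union>Q)"
      by (rule card_le_twice_mrank) (use Z QE in blast)
    ultimately show "card Z + card Q \<le> mrank \<I> (Z \<union> \<Union>Q)" using rest by linarith
  qed
  show ?thesis
    using split_pairs[OF P, of "E - \<Union>P" "{}"] ext P(4) by (auto simp: Un_absorb2)
qed

end

section \<open>Pairings that follow a laminar family\<close>

text \<open>
  The first pair is taken inside a smallest member with at least two elements, \<open>E\<close> itself being
  available as a last resort. By laminarity another member containing just one element of
  this pair lies properly inside the chosen one, so it is a singleton and causes no harm.
  All other members contain both elements or neither, and the pair can be removed from the ground
  set.
\<close>

lemma laminar_pairing:
  assumes "finite E" "\<A> \<subseteq> Pow E" "laminar \<A>"
  shows "\<exists>P. finite P \<and> disjoint P \<and> (\<forall>p\<in>P. card p = 2) \<and> \<Union>P \<subseteq> E \<and> card (E - \<Union>P) \<le> 1 \<and>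
    (\<forall>X A. (\<forall>p\<in>P. card (X \<inter> p) = 1) \<longrightarrow> A \<in> \<A> \<longrightarrow> 2 * card (X \<inter> A) \<le> card A + 1)"
  using assms
proof (induction "card E" arbitrary: E \<A> rule: less_induct)
  case less
  note fin = \<open>finite E\<close>
  have sub: "A \<subseteq> E" if "A \<in> \<A>" for A using that less.prems(2) by blast
  show ?case
  proof (cases "card E \<le> 1")
    case True
    have "2 * card (X \<inter> A) \<le> card A + 1" if "A \<in> \<A>" for X A
    proof -
      have "finite A" "card A \<le> card E"
        using sub[OF that] fin finite_subset card_mono by blast+
      moreover have "card (X \<inter> A) \<le> card A" by (rule card_mono[OF \<open>finite A\<close>]) blast
      ultimately show ?thesis using True by linarith
    qed
    then show ?thesis using True by (intro exI[of _ "{}"]) (auto simp: disjoint_def)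
  next
    case False
    define big where "big A \<longleftrightarrow> A \<in> insert E \<A> \<and> 2 \<le> card A" for A
    have "big E" using False unfolding big_def by simp
    then obtain A where A: "big A" and small: "\<And>B. big B \<Longrightarrow> card A \<le> card B"
      using ex_has_least_nat[of big E card] by blast
    have AE: "A \<subseteq> E" using A sub unfolding big_def by blast
    obtain p where p: "p \<subseteq> A" "card p = 2"
      using A obtain_subset_with_card_n[of 2 A] unfolding big_def by blast
    then obtain a b where ab: "p = {a, b}" "a \<noteq> b" using card_2_iff by metis
    have pE: "p \<subseteq> E" using p(1) AE by blast
    have cases: "p \<subseteq> B \<or> p \<inter> B = {} \<or> card B \<le> 1" if B: "B \<in> \<A>" for B
    proof (rule ccontr)
      assume no: "\<not> ?thesis"
      then have "\<not> A \<subseteq> B" "A \<inter> B \<noteq> {}" using p(1) by blast+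
      then have "B \<subset> A"
        using A B less.prems(3) sub[OF B] unfolding big_def laminar_def by blast
      then have "card B < card A" using AE fin finite_subset psubset_card_mono by blast
      moreover have "big B" using B no unfolding big_def by simp
      ultimately show False using small by fastforce
    qed
    let ?E = "E - p" and ?\<A> = "(\<lambda>B. B - p) ` \<A>"
    have "card ?E < card E" using pE ab fin by (intro psubset_card_mono) auto
    moreover have "?\<A> \<subseteq> Pow ?E" using less.prems(2) by blast
    moreover have "laminar ?\<A>" using less.prems(3) unfolding laminar_def by blast
    ultimately obtain P where P: "finite P" "disjoint P" "\<forall>p\<in>P. card p = 2" "\<Union>P \<subseteq> ?E"
      "card (?E - \<Union>P) \<le> 1"
      "\<And>X B. \<forall>p\<in>P. card (X \<inter> p) = 1 \<Longrightarrow> B \<in> ?\<A> \<Longrightarrow> 2 * card (X \<inter> B) \<le> card B + 1"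
      using less.hyps[of ?E ?\<A>] fin by (metis (no_types, lifting) finite_Diff)
    have disj: "disjoint (insert p P)" using P(2,4) unfolding disjoint_def by blast
    have rest: "E - \<Union>(insert p P) = ?E - \<Union>P" by blast
    have "2 * card (X \<inter> B) \<le> card B + 1"
      if X: "\<forall>p\<in>insert p P. card (X \<inter> p) = 1" and B: "B \<in> \<A>" for X B
    proof -
      have finB: "finite B" using sub[OF B] fin finite_subset by blast
      have IH: "2 * card (X \<inter> (B - p)) \<le> card (B - p) + 1"
        using P(6)[of X "B - p"] X B by blast
      consider "p \<subseteq> B" | "p \<inter> B = {}" | "card B \<le> 1" using cases[OF B] by blast
      then show ?thesis
      proof cases
        case 1
        have "B = (B - p) \<union> p" using 1 by blast
        then have "card B = card (B - p) + 2"
          using card_Un_disjoint[of "B - p" p] finB 1 p(2) finite_subset by fastforce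
        moreover have "X \<inter> B = (X \<inter> (B - p)) \<union> (X \<inter> p)" using 1 by blast
        then have "card (X \<inter> B) \<le> card (X \<inter> (B - p)) + 1"
          using card_Un_le[of "X \<inter> (B - p)" "X \<inter> p"] X by simp
        ultimately show ?thesis using IH by linarith
      next
        case 2
        then have "B - p = B" by blast
        then show ?thesis using IH by simp
      next
        case 3
        then show ?thesis using card_mono[OF finB, of "X \<inter> B"] by simp
      qed
    qed
    then show ?thesis
      using P(1,3,4,5) p(2) pE disj rest by (intro exI[of _ "insert p P"]) auto
  qed
qed

section \<open>Common independent sets\<close>

theorem theorem3p16:
  fixes E :: "'a set" and \<I>\<^sub>1 \<I>\<^sub>2 :: "'a set set"
  assumes "laminar_matroid E \<I>\<^sub>1"
    and "E \<in> k_fold_indep E \<I>\<^sub>1 2"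
    and "matroid E \<I>\<^sub>2"
    and "\<not> (\<exists>e\<in>E. m_spanned E \<I>\<^sub>2 3 e)"
  shows "\<exists>X\<^sub>1 X\<^sub>2. X\<^sub>1 \<union> X\<^sub>2 = E \<and> X\<^sub>1 \<inter> X\<^sub>2 = {} \<and>
           X\<^sub>1 \<in> \<I>\<^sub>1 \<inter> \<I>\<^sub>2 \<and> X\<^sub>2 \<in> \<I>\<^sub>1 \<inter> \<I>\<^sub>2"
proof -
  interpret M2: matroid_without_3_spanned E \<I>\<^sub>2
    using assms(3,4) by (intro matroid_without_3_spanned.intro)
      (auto simp: matroid_without_3_spanned_axioms_def)
  obtain \<A> q where \<A>: "\<A> \<subseteq> Pow E" "laminar \<A>"
    and \<I>1: "\<I>\<^sub>1 = {X. X \<subseteq> E \<and> (\<forall>A\<in>\<A>. card (X \<inter> A) \<le> q A)}"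
    using assms(1) unfolding laminar_matroid_def by blast
  obtain F :: "nat \<Rightarrow> 'a set" where F: "(\<Union>i<2. F i) = E" "\<forall>i<2. F i \<in> \<I>\<^sub>1"
    using assms(2) unfolding k_fold_indep_def by blast
  have card_A: "card A \<le> 2 * q A" if A: "A \<in> \<A>" for A
  proof -
    have "E = F 0 \<union> F 1" using F(1) by (auto simp: lessThan_Suc numeral_2_eq_2)
    then have "A = (F 0 \<inter> A) \<union> (F 1 \<inter> A)" using A \<A>(1) by blast
    then have "card A \<le> card (F 0 \<inter> A) + card (F 1 \<inter> A)" by (metis card_Un_le)
    moreover have "card (F 0 \<inter> A) \<le> q A" "card (F 1 \<inter> A) \<le> q A"
      using F(2) A unfolding \<I>1 by auto
    ultimately show ?thesis by linarith
  qed
  obtain P where P: "finite P" "disjoint P" "\<forall>p\<in>P. card p = 2" "\<Union>P \<subseteq> E" "card (E - \<Union>P) \<le> 1"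
    and half: "\<And>X A. \<forall>p\<in>P. card (X \<inter> p) = 1 \<Longrightarrow> A \<in> \<A> \<Longrightarrow> 2 * card (X \<inter> A) \<le> card A + 1"
    using laminar_pairing[OF M2.finite_ground \<A>] by blast
  have transversal_indep: "X \<in> \<I>\<^sub>1" if "X \<subseteq> E" "\<forall>p\<in>P. card (X \<inter> p) = 1" for X
  proof -
    have "card (X \<inter> A) \<le> q A" if A: "A \<in> \<A>" for A
      using half[OF \<open>\<forall>p\<in>P. card (X \<inter> p) = 1\<close> A] card_A[OF A] by linarith
    then show ?thesis using \<open>X \<subseteq> E\<close> unfolding \<I>1 by blast
  qed
  obtain X Y where XY: "X \<in> \<I>\<^sub>2" "Y \<in> \<I>\<^sub>2" "X \<inter> Y = {}" "X \<union> Y = E"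
    "\<forall>p\<in>P. card (X \<inter> p) = 1 \<and> card (Y \<inter> p) = 1"
    using M2.split_pairing[OF P] by blast
  then have "X \<in> \<I>\<^sub>1" "Y \<in> \<I>\<^sub>1" using transversal_indep by blast+
  then show ?thesis using XY by blast
qed

end
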